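(* Let $X\subseteq\omega$ be a non-recursive (i.e. non-computable) set. Every non-empty $\Pi^0_1$ class $\mathcal{P}\subseteq 2^\omega$ contains a countable sequence of sets whose infinite join does not compute $X$; that is, there is a sequence $\{A_i\}_{i\in\omega}$ with $A_i\in\mathcal{P}$ for all $i\in\omega$ such that $X\not\leq_T\bigoplus\{A_i\}_{i\in\omega}$.
   Context: $\omega$ is the set of natural numbers; $2^{<\omega}$ is the set of finite binary strings; a set $A\subseteq\omega$ is identified with its characteristic function, an element of Cantor space $2^\omega$. $\leq_T$ is Turing reducibility. A set $\Lambda\subseteq 2^{<\omega}$ is downward closed if whenever $\sigma\in\Lambda$ and $\tau$ is an initial segment of $\sigma$, then $\tau\in\Lambda$. $[\Lambda]$ denotes the set of infinite paths through $\Lambda$, i.e. all $A\in 2^\omega$ every initial segment of which is in $\Lambda$. A class $\mathcal{P}\subseteq 2^\omega$ is a $\Pi^0_1$ class if $\mathcal{P}=[\Lambda]$ for some computable downward closed set of strings $\Lambda$. Let $\langle i,j\rangle$ be a fixed computable bijection $\omega\times\omega\to\omega$. For a countable sequence of sets $\{A_i\}_{i\in\omega}$, the infinite join is $\bigoplus\{A_i\}_{i\in\omega}=\{\langle i,x\rangle : x\in A_i\}$. *)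

theory Defs
  imports "HOL-Library.Nat_Bijection" "HOL-Library.Sublist"
begin

(* Codes for the functions that are partial recursive relative to an oracle: Kleene's
   schemes together with one further unary initial function, the characteristic function
   of the oracle.  Codes carry no arity: a code applied to argument lists of one fixed
   length k determines a k-ary partial function. *)
datatype recf =
    Zero
  | Succ
  | Proj nat
  | Oracle
  | Comp recf "recf list"
  | Prim recf recf
  | Mu recf

definition char_fun :: "nat set \<Rightarrow> nat \<Rightarrow> nat" where
  "char_fun A x = (if x \<in> A then 1 else 0)"

(* computes A c xs y: the computation of c on xs with oracle A halts with value y. *)
inductive computes :: "nat set \<Rightarrow> recf \<Rightarrow> nat list \<Rightarrow> nat \<Rightarrow> bool" for A :: "nat set" where
  Zero: "computes A Zero xs 0"
| Succ: "computes A Succ [x] (Suc x)"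
| Proj: "i < length xs \<Longrightarrow> computes A (Proj i) xs (xs ! i)"
| Oracle: "computes A Oracle [x] (char_fun A x)"
| Comp: "list_all2 (\<lambda>g y. computes A g xs y) gs ys \<Longrightarrow> computes A f ys z
    \<Longrightarrow> computes A (Comp f gs) xs z"
| Prim_0: "computes A f xs y \<Longrightarrow> computes A (Prim f g) (0 # xs) y"
| Prim_Suc: "computes A (Prim f g) (n # xs) y \<Longrightarrow> computes A g (n # y # xs) z
    \<Longrightarrow> computes A (Prim f g) (Suc n # xs) z"
| Mu: "computes A f (n # xs) 0 \<Longrightarrow> (\<And>m. m < n \<Longrightarrow> \<exists>k. computes A f (m # xs) (Suc k))
    \<Longrightarrow> computes A (Mu f) xs n"

lemma computes_deterministic:
  "computes A c xs y \<Longrightarrow> computes A c xs z \<Longrightarrow> y = z"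
proof (induction arbitrary: z rule: computes.induct)
  case (Comp xs gs ys f w)
  from Comp.prems obtain ys' where ys': "list_all2 (\<lambda>g y. computes A g xs y) gs ys'"
      and z: "computes A f ys' z"
    by cases blast
  have "ys = ys'"
    using Comp.IH(1) ys'
    by (auto simp: list_all2_conv_all_nth intro!: nth_equalityI)
  then show ?case using Comp.IH(2) z by blast
next
  case (Prim_0 f xs y g)
  from Prim_0.prems show ?case by cases (use Prim_0.IH in blast)
next
  case (Prim_Suc f g n xs y w)
  from Prim_Suc.prems obtain y' where "computes A (Prim f g) (n # xs) y'"
      and "computes A g (n # y' # xs) z"
    by cases blast
  then show ?case using Prim_Suc.IH by blast
next
  case (Mu f n xs)
  from Mu.prems have z0: "computes A f (z # xs) 0"
      and below: "\<And>m. m < z \<Longrightarrow> \<exists>k. computes A f (m # xs) (Suc k)"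
    by (cases, blast)+
  have "\<not> z < n" using Mu.IH(2) z0 by (metis nat.distinct(1))
  moreover have "\<not> n < z" using Mu.IH(1) below by (metis nat.distinct(1))
  ultimately show ?case by simp
qed (erule computes.cases; simp)+

definition turing_le :: "nat set \<Rightarrow> nat set \<Rightarrow> bool"  (infix "\<le>\<^sub>T" 50) where
  "X \<le>\<^sub>T A \<longleftrightarrow> (\<exists>c. \<forall>x. computes A c [x] (char_fun X x))"

(* With the empty oracle, Oracle is just the constant zero function. *)
definition computable :: "nat set \<Rightarrow> bool" where
  "computable X \<longleftrightarrow> X \<le>\<^sub>T {}"

definition string_code :: "bool list \<Rightarrow> nat" where
  "string_code \<sigma> = list_encode (map of_bool \<sigma>)"

definition computable_strings :: "bool list set \<Rightarrow> bool" where
  "computable_strings \<Lambda> \<longleftrightarrow> computable (string_code ` \<Lambda>)"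

definition downward_closed :: "bool list set \<Rightarrow> bool" where
  "downward_closed \<Lambda> \<longleftrightarrow> (\<forall>\<sigma>\<in>\<Lambda>. \<forall>\<tau>. prefix \<tau> \<sigma> \<longrightarrow> \<tau> \<in> \<Lambda>)"

definition initial_segment :: "nat set \<Rightarrow> nat \<Rightarrow> bool list" where
  "initial_segment A n = map (\<lambda>k. k \<in> A) [0..<n]"

definition paths :: "bool list set \<Rightarrow> nat set set" where
  "paths \<Lambda> = {A. \<forall>n. initial_segment A n \<in> \<Lambda>}"

definition Pi01_class :: "nat set set \<Rightarrow> bool" where
  "Pi01_class P \<longleftrightarrow> (\<exists>\<Lambda>. computable_strings \<Lambda> \<and> downward_closed \<Lambda> \<and> P = paths \<Lambda>)"

(* The pairing function prod_encode is Cantor's, hence a computable bijection. *)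
definition infinite_join :: "(nat \<Rightarrow> nat set) \<Rightarrow> nat set" where
  "infinite_join A = {prod_encode (i, x) | i x. x \<in> A i}"

end

theory Submission
  imports Defs "HOL-Library.Countable" "HOL-Library.Infinite_Set" "HOL-Library.Diagonal_Subsequence"
begin

text \<open>
  A constant sequence suffices: the join of \<open>A, A, A, \<dots>\<close> is computable from \<open>A\<close>, so the theorem
  follows from the cone avoidance basis theorem for \<open>\<Pi>\<^sup>0\<^sub>1\<close> classes (\<open>cone_avoidance\<close>), that every
  non-empty \<open>\<Pi>\<^sup>0\<^sub>1\<close> class has a member which does not compute \<open>X\<close>.

  The \<open>\<Pi>\<^sup>0\<^sub>1\<close> classes are handled as the classes \<open>avoiding D\<close> of all oracles on which no code in the
  finite set \<open>D\<close> halts (\<open>Pi01_class_avoiding\<close>). Adding a code to \<open>D\<close> shrinks the class, and for given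
  \<open>c\<close>, \<open>x\<close> and \<open>y\<close> there is a code that halts on exactly the oracles for which \<open>c\<close> outputs \<open>y\<close> at \<open>x\<close>
  (\<open>code_halting_iff_output\<close>). Hence, given a non-empty \<open>avoiding D\<close> and a code \<open>c\<close>, either some
  \<open>avoiding (insert d D)\<close> is non-empty and has no member from which \<open>c\<close> computes \<open>X\<close>, or \<open>c\<close> computes
  \<open>X\<close> from every member of \<open>avoiding D\<close>. In the latter case \<open>X\<close> is computable
  (\<open>computable_if_computed_on_avoiding\<close>): to find out whether \<open>x\<close> is in \<open>X\<close>, search for an \<open>n\<close> and a
  value \<open>y\<close> such that for each of the \<open>2^n\<close> oracles restricted to \<open>{..<n}\<close>, the approximation by \<open>n\<close>
  shows that a code in \<open>D\<close> halts or that \<open>c\<close> outputs \<open>y\<close>. Compactness gives such an \<open>n\<close> for the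
  correct \<open>y\<close>, and a member of \<open>avoiding D\<close> rules out any other \<open>y\<close>. Treating all codes in turn
  gives a decreasing sequence of non-empty classes, and by compactness they have a common member
  (\<open>avoiding_limit\<close>).

  The approximations (\<open>approx\<close>) are total functions that only ask the oracle about numbers below \<open>n\<close>
  and that only search below \<open>n\<close>. They are sound (\<open>approx_sound\<close>), and along any convergent
  sequence of oracles with \<open>n\<close> tending to infinity they eventually produce every value computed
  from the limit oracle (\<open>approx_complete\<close>). Monotonicity in \<open>n\<close> is not needed. For each code they
  are recursive uniformly in \<open>n\<close> and in a code of the finite oracle (\<open>recursive_approx\<close>).
\<close>

lemma char_fun_eq_of_bool: "char_fun A x = of_bool (x \<in> A)"
  by (simp add: char_fun_def)

section \<open>Total recursive functionals\<close>

text \<open>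
  A functional taking an oracle and \<open>k\<close> numbers is recursive if one code computes it for all oracles.
  Only its values on lists of length \<open>k\<close> matter.
\<close>
definition recursive :: "nat \<Rightarrow> (nat set \<Rightarrow> nat list \<Rightarrow> nat) \<Rightarrow> bool" where
  "recursive k F \<longleftrightarrow> (\<exists>c. \<forall>A xs. length xs = k \<longrightarrow> computes A c xs (F A xs))"

text \<open>
  The analogue for functionals whose value is a list of fixed length \<open>l\<close>. With such argument
  lists, composition needs no reference to the single components.
\<close>
definition recursive_vec :: "nat \<Rightarrow> nat \<Rightarrow> (nat set \<Rightarrow> nat list \<Rightarrow> nat list) \<Rightarrow> bool" where
  "recursive_vec k l L \<longleftrightarrow> (\<forall>A xs. length xs = k \<longrightarrow> length (L A xs) = l) \<and>
     (\<forall>i<l. recursive k (\<lambda>A xs. L A xs ! i))"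

text \<open>Relations of an oracle and \<open>k\<close> numbers that are decidable uniformly in the oracle.\<close>
definition decidable :: "nat \<Rightarrow> (nat set \<Rightarrow> nat list \<Rightarrow> bool) \<Rightarrow> bool" where
  "decidable k P \<longleftrightarrow> recursive k (\<lambda>A xs. of_bool (P A xs))"

lemma recursive_cong:
  assumes "recursive k F" "\<And>A xs. length xs = k \<Longrightarrow> F A xs = G A xs"
  shows "recursive k G"
  using assms unfolding recursive_def by metis

lemma recursive_nth: "i < k \<Longrightarrow> recursive k (\<lambda>A xs. xs ! i)"
  unfolding recursive_def by (metis computes.Proj)

lemma recursive_comp:
  assumes "recursive l F" "recursive_vec k l L"
  shows "recursive k (\<lambda>A xs. F A (L A xs))"
proof -
  obtain c where c: "\<And>A ys. length ys = l \<Longrightarrow> computes A c ys (F A ys)"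
    using assms(1) unfolding recursive_def by blast
  have len: "\<And>A xs. length xs = k \<Longrightarrow> length (L A xs) = l"
    using assms(2) unfolding recursive_vec_def by blast
  have "\<forall>i<l. \<exists>g. \<forall>A xs. length xs = k \<longrightarrow> computes A g xs (L A xs ! i)"
    using assms(2) unfolding recursive_vec_def recursive_def by blast
  then obtain g where g: "\<And>i A xs. i < l \<Longrightarrow> length xs = k \<Longrightarrow> computes A (g i) xs (L A xs ! i)"
    by metis
  have "computes A (Comp c (map g [0..<l])) xs (F A (L A xs))" if "length xs = k" for A xs
    by (rule computes.Comp[where ys = "L A xs"])
       (auto simp: list_all2_conv_all_nth len that intro: g c)
  then show ?thesis unfolding recursive_def by blast
qed

lemma recursive_vec_id: "recursive_vec k k (\<lambda>A xs. xs)"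
  by (simp add: recursive_vec_def recursive_nth)

lemma recursive_vec_Nil: "recursive_vec k 0 (\<lambda>A xs. [])"
  by (simp add: recursive_vec_def)

lemma recursive_vec_Cons:
  assumes "recursive k F" "recursive_vec k l L"
  shows "recursive_vec k (Suc l) (\<lambda>A xs. F A xs # L A xs)"
proof -
  have "recursive k (\<lambda>A xs. (F A xs # L A xs) ! i)" if "i < Suc l" for i
    using assms that by (cases i) (auto simp: recursive_vec_def)
  then show ?thesis using assms by (simp add: recursive_vec_def)
qed

lemma recursive_vec_tl:
  assumes "recursive_vec k (Suc l) L"
  shows "recursive_vec k l (\<lambda>A xs. tl (L A xs))"
proof -
  have "recursive k (\<lambda>A xs. tl (L A xs) ! i)" if "i < l" for i
  proof (rule recursive_cong)
    show "recursive k (\<lambda>A xs. L A xs ! Suc i)"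
      using assms that by (simp add: recursive_vec_def)
  qed (use assms that in \<open>simp add: recursive_vec_def nth_tl\<close>)
  then show ?thesis using assms by (simp add: recursive_vec_def)
qed

lemma recursive_hd:
  assumes "recursive_vec k (Suc l) L"
  shows "recursive k (\<lambda>A xs. hd (L A xs))"
proof (rule recursive_cong)
  show "recursive k (\<lambda>A xs. L A xs ! 0)"
    using assms by (simp add: recursive_vec_def)
  show "L A xs ! 0 = hd (L A xs)" if "length xs = k" for A xs
    using assms that by (metis recursive_vec_def hd_conv_nth length_0_conv nat.distinct(1))
qed

lemma recursive_Suc:
  assumes "recursive k F"
  shows "recursive k (\<lambda>A xs. Suc (F A xs))"
proof -
  have "recursive 1 (\<lambda>A xs. Suc (hd xs))"
    unfolding recursive_def
    by (rule exI[of _ Succ]) (auto simp: length_Suc_conv intro: computes.Succ)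
  from recursive_comp[OF this, of k "\<lambda>A xs. [F A xs]"] show ?thesis
    using recursive_vec_Cons[OF assms recursive_vec_Nil] by simp
qed

lemma recursive_const: "recursive k (\<lambda>A xs. n)"
proof (induction n)
  case 0
  show ?case unfolding recursive_def using computes.Zero by blast
qed (rule recursive_Suc)

lemma recursive_oracle:
  assumes "recursive k F"
  shows "recursive k (\<lambda>A xs. char_fun A (F A xs))"
proof -
  have "recursive 1 (\<lambda>A xs. char_fun A (hd xs))"
    unfolding recursive_def
    by (rule exI[of _ Oracle]) (auto simp: length_Suc_conv intro: computes.Oracle)
  from recursive_comp[OF this, of k "\<lambda>A xs. [F A xs]"] show ?thesis
    using recursive_vec_Cons[OF assms recursive_vec_Nil] by simp
qed

text \<open>
  In this rule and in the rules for \<open>LEAST\<close> and bounded quantifiers, the bound variables are put in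
  front of the parameter list.
\<close>
lemma recursive_rec_nat:
  assumes n: "recursive k N" and f: "recursive k F"
    and g: "recursive (Suc (Suc k)) (\<lambda>A ys. G A (hd ys) (hd (tl ys)) (tl (tl ys)))"
  shows "recursive k (\<lambda>A xs. rec_nat (F A xs) (\<lambda>m y. G A m y xs) (N A xs))"
proof -
  obtain cf where cf: "\<And>A xs. length xs = k \<Longrightarrow> computes A cf xs (F A xs)"
    using f unfolding recursive_def by blast
  obtain cg where cg: "\<And>A ys. length ys = Suc (Suc k) \<Longrightarrow>
      computes A cg ys (G A (hd ys) (hd (tl ys)) (tl (tl ys)))"
    using g unfolding recursive_def by blast
  have "computes A (Prim cf cg) (m # xs) (rec_nat (F A xs) (\<lambda>m y. G A m y xs) m)"
    if "length xs = k" for A xs m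
  proof (induction m)
    case 0
    then show ?case by (simp add: cf computes.Prim_0 that)
  next
    case (Suc m)
    then show ?case
      using cg[of "m # rec_nat (F A xs) (\<lambda>m y. G A m y xs) m # xs" A] that
      by (auto intro: computes.Prim_Suc)
  qed
  then have "recursive (Suc k) (\<lambda>A ys. rec_nat (F A (tl ys)) (\<lambda>m y. G A m y (tl ys)) (hd ys))"
    unfolding recursive_def by (intro exI[of _ "Prim cf cg"]) (auto simp: length_Suc_conv)
  from recursive_comp[OF this recursive_vec_Cons[OF n recursive_vec_id]]
  show ?thesis by simp
qed

lemma recursive_Least_zero:
  assumes f: "recursive (Suc k) (\<lambda>A ys. F A (hd ys) (tl ys))"
    and ex: "\<And>A xs. length xs = k \<Longrightarrow> \<exists>m. F A m xs = 0"
  shows "recursive k (\<lambda>A xs. LEAST m. F A m xs = 0)"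
proof -
  obtain c where c: "\<And>A ys. length ys = Suc k \<Longrightarrow> computes A c ys (F A (hd ys) (tl ys))"
    using f unfolding recursive_def by blast
  have "computes A (Mu c) xs (LEAST m. F A m xs = 0)" if xs: "length xs = k" for A xs
  proof (rule computes.Mu)
    show "computes A c ((LEAST m. F A m xs = 0) # xs) 0"
      using c[of "(LEAST m. F A m xs = 0) # xs" A] LeastI_ex[OF ex[OF xs, of A]] xs by simp
    fix m assume "m < (LEAST m. F A m xs = 0)"
    then have "F A m xs \<noteq> 0" by (rule not_less_Least)
    then obtain j where "F A m xs = Suc j" using not0_implies_Suc by blast
    then show "\<exists>j. computes A c (m # xs) (Suc j)" using c[of "m # xs" A] xs by auto
  qed
  then show ?thesis unfolding recursive_def by blast
qed

lemmas recursive_vec_intros =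
  recursive_vec_Cons recursive_vec_Nil recursive_vec_tl recursive_vec_id

lemma recursive_pred:
  assumes "recursive k F"
  shows "recursive k (\<lambda>A xs. F A xs - 1)"
proof -
  have eq: "rec_nat 0 (\<lambda>m y. m) n = n - 1" for n by (cases n) auto
  have "recursive k (\<lambda>A xs. rec_nat 0 (\<lambda>m y. m) (F A xs))"
    by (rule recursive_rec_nat) (rule assms recursive_const recursive_hd recursive_vec_intros)+
  then show ?thesis by (simp only: eq)
qed

lemma recursive_add:
  assumes "recursive k F" "recursive k G"
  shows "recursive k (\<lambda>A xs. F A xs + G A xs)"
proof -
  have eq: "rec_nat m (\<lambda>_ y. Suc y) n = m + n" for m n by (induction n) auto
  have "recursive k (\<lambda>A xs. rec_nat (F A xs) (\<lambda>_ y. Suc y) (G A xs))"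
    by (rule recursive_rec_nat) (rule assms recursive_Suc recursive_hd recursive_vec_intros)+
  then show ?thesis by (simp only: eq)
qed

lemma recursive_diff:
  assumes "recursive k F" "recursive k G"
  shows "recursive k (\<lambda>A xs. F A xs - G A xs)"
proof -
  have eq: "rec_nat m (\<lambda>_ y. y - 1) n = m - n" for m n by (induction n) auto
  have "recursive k (\<lambda>A xs. rec_nat (F A xs) (\<lambda>_ y. y - 1) (G A xs))"
    by (rule recursive_rec_nat) (rule assms recursive_pred recursive_hd recursive_vec_intros)+
  then show ?thesis by (simp only: eq)
qed

lemma decidable_not:
  assumes "decidable k P"
  shows "decidable k (\<lambda>A xs. \<not> P A xs)"
proof -
  have "recursive k (\<lambda>A xs. 1 - of_bool (P A xs))"
    by (rule recursive_diff recursive_const assms[unfolded decidable_def])+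
  then show ?thesis unfolding decidable_def by (rule recursive_cong) simp
qed

lemma decidable_conj:
  assumes "decidable k P" "decidable k Q"
  shows "decidable k (\<lambda>A xs. P A xs \<and> Q A xs)"
proof -
  have "recursive k (\<lambda>A xs. of_bool (P A xs) + of_bool (Q A xs) - 1)"
    by (rule recursive_diff recursive_add recursive_const assms[unfolded decidable_def])+
  then show ?thesis unfolding decidable_def by (rule recursive_cong) simp
qed

lemma decidable_disj:
  assumes "decidable k P" "decidable k Q"
  shows "decidable k (\<lambda>A xs. P A xs \<or> Q A xs)"
  using decidable_not[OF decidable_conj[OF decidable_not[OF assms(1)] decidable_not[OF assms(2)]]]
  by simp

lemma decidable_le:
  assumes "recursive k F" "recursive k G"
  shows "decidable k (\<lambda>A xs. F A xs \<le> G A xs)"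
proof -
  have "recursive k (\<lambda>A xs. 1 - (F A xs - G A xs))"
    by (rule recursive_diff recursive_const assms)+
  then show ?thesis unfolding decidable_def by (rule recursive_cong) simp
qed

lemma decidable_less:
  assumes "recursive k F" "recursive k G"
  shows "decidable k (\<lambda>A xs. F A xs < G A xs)"
  using decidable_not[OF decidable_le[OF assms(2,1)]] by (simp add: not_le)

lemma decidable_eq:
  assumes "recursive k F" "recursive k G"
  shows "decidable k (\<lambda>A xs. F A xs = G A xs)"
  using decidable_conj[OF decidable_le[OF assms] decidable_le[OF assms(2,1)]]
  by (simp add: eq_iff)

lemma recursive_If:
  assumes "decidable k P" "recursive k F" "recursive k G"
  shows "recursive k (\<lambda>A xs. if P A xs then F A xs else G A xs)"
proof -
  have "recursive k (\<lambda>A xs. rec_nat (G A xs) (\<lambda>_ _. F A xs) (of_bool (P A xs)))"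
    by (rule recursive_rec_nat)
       (rule assms assms[unfolded decidable_def] recursive_comp[OF assms(2)] recursive_vec_intros)+
  then show ?thesis by (rule recursive_cong) simp
qed

lemma decidable_all_less:
  assumes N: "recursive k N" and P: "decidable (Suc k) (\<lambda>A ys. P A (hd ys) (tl ys))"
  shows "decidable k (\<lambda>A xs. \<forall>m<N A xs. P A m xs)"
proof -
  have eq: "rec_nat 1 (\<lambda>m y. if P A m xs then y else 0) n = (of_bool (\<forall>m<n. P A m xs) :: nat)"
    for A xs n by (induction n) (auto simp: less_Suc_eq)
  have P': "decidable (Suc (Suc k)) (\<lambda>A ys. P A (hd ys) (tl (tl ys)))"
    unfolding decidable_def
    by (rule recursive_comp[OF P[unfolded decidable_def],
          of "Suc (Suc k)" "\<lambda>A ys. hd ys # tl (tl ys)", unfolded list.sel])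
       (rule recursive_vec_intros recursive_hd)+
  have "recursive k (\<lambda>A xs. rec_nat 1 (\<lambda>m y. if P A m xs then y else 0) (N A xs))"
    by (rule recursive_rec_nat)
       (rule N P' recursive_const recursive_If recursive_hd recursive_vec_intros)+
  then show ?thesis by (simp only: eq decidable_def)
qed

lemma decidable_ex_less:
  assumes "recursive k N" "decidable (Suc k) (\<lambda>A ys. P A (hd ys) (tl ys))"
  shows "decidable k (\<lambda>A xs. \<exists>m<N A xs. P A m xs)"
  using decidable_not[OF decidable_all_less[OF assms(1) decidable_not[OF assms(2)]]] by simp

lemma recursive_Least:
  assumes P: "decidable (Suc k) (\<lambda>A ys. P A (hd ys) (tl ys))"
    and ex: "\<And>A xs. length xs = k \<Longrightarrow> \<exists>m. P A m xs"
  shows "recursive k (\<lambda>A xs. LEAST m. P A m xs)"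
proof -
  have "recursive k (\<lambda>A xs. LEAST m. of_bool (\<not> P A m xs) = (0::nat))"
    by (rule recursive_Least_zero)
       (use decidable_not[OF P] ex in \<open>auto simp: decidable_def\<close>)
  then show ?thesis by simp
qed

lemma decidable_Bex_set:
  assumes "\<And>g. g \<in> set gs \<Longrightarrow> decidable k (P g)"
  shows "decidable k (\<lambda>A xs. \<exists>g\<in>set gs. P g A xs)"
  using assms
proof (induction gs)
  case Nil
  then show ?case using recursive_const[of k 0] by (simp add: decidable_def)
next
  case (Cons g gs)
  then show ?case using decidable_disj[of k "P g"] by simp
qed

lemmas recursive_intros =
  recursive_hd recursive_const recursive_Suc recursive_add recursive_diff recursive_If
  decidable_not decidable_conj decidable_disj decidable_le decidable_less decidable_eq
  recursive_vec_intros

section \<open>Arithmetic of the codings\<close>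

lemma recursive_pow2:
  assumes "recursive k F"
  shows "recursive k (\<lambda>A xs. 2 ^ F A xs)"
proof -
  have eq: "rec_nat 1 (\<lambda>_ y. y + y) n = (2::nat) ^ n" for n by (induction n) auto
  have "recursive k (\<lambda>A xs. rec_nat 1 (\<lambda>_ y. y + y) (F A xs))"
    by (rule recursive_rec_nat) (rule assms recursive_intros)+
  then show ?thesis by (simp only: eq)
qed

lemma recursive_div2:
  assumes "recursive k F"
  shows "recursive k (\<lambda>A xs. F A xs div 2)"
proof -
  have eq: "(LEAST m. n \<le> Suc (m + m)) = n div 2" for n :: nat
    by (rule Least_equality) auto
  have "recursive k (\<lambda>A xs. LEAST m. F A xs \<le> Suc (m + m))"
  proof (rule recursive_Least)
    show "decidable (Suc k) (\<lambda>A ys. F A (tl ys) \<le> Suc (hd ys + hd ys))"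
      by (rule recursive_intros recursive_comp[OF assms])+
    show "\<exists>m. F A xs \<le> Suc (m + m)" for A xs by (rule exI[of _ "F A xs"]) simp
  qed
  then show ?thesis by (simp only: eq)
qed

lemma decidable_in_set_decode:
  assumes "recursive k F" "recursive k G"
  shows "decidable k (\<lambda>A xs. F A xs \<in> set_decode (G A xs))"
proof -
  have eq: "rec_nat a (\<lambda>_ y. y div 2) n = a div 2 ^ n" for a n :: nat
    by (induction n) (simp_all add: div_mult2_eq[symmetric] mult.commute)
  have "recursive k (\<lambda>A xs. rec_nat (G A xs) (\<lambda>_ y. y div 2) (F A xs))"
    by (rule recursive_rec_nat) (rule assms recursive_div2 recursive_intros)+
  then have D: "recursive k (\<lambda>A xs. G A xs div 2 ^ F A xs)" by (simp only: eq)
  have odd: "odd a \<longleftrightarrow> a = Suc (a div 2 + a div 2)" for a :: nat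
    by presburger
  show ?thesis
    unfolding set_decode_def mem_Collect_eq odd
    by (rule recursive_intros recursive_div2 D)+
qed

lemma recursive_prod_encode:
  assumes "recursive k F" "recursive k G"
  shows "recursive k (\<lambda>A xs. prod_encode (F A xs, G A xs))"
proof -
  have eq: "rec_nat 0 (\<lambda>m y. y + Suc m) n = triangle n" for n by (induction n) auto
  have "recursive k (\<lambda>A xs. rec_nat 0 (\<lambda>m y. y + Suc m) (F A xs + G A xs))"
    by (rule recursive_rec_nat) (rule assms recursive_intros)+
  then have "recursive k (\<lambda>A xs. triangle (F A xs + G A xs))" by (simp only: eq)
  from recursive_add[OF this assms(1)] show ?thesis
    by (simp add: prod_encode_def)
qed

lemma recursive_snd_prod_decode:
  assumes "recursive k F"
  shows "recursive k (\<lambda>A xs. snd (prod_decode (F A xs)))"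
proof -
  \<comment> \<open>The components of a pair do not exceed its code, so a bounded search for the first one suffices.\<close>
  have eq: "(\<exists>x<Suc z. z = prod_encode (x, y)) \<longleftrightarrow> y = snd (prod_decode z)" for y z
    by (metis le_prod_encode_1 less_Suc_eq_le prod.collapse prod_decode_inverse
        prod_encode_inverse snd_conv)
  have "recursive k (\<lambda>A xs. LEAST y. \<exists>x<Suc (F A xs). F A xs = prod_encode (x, y))"
  proof (rule recursive_Least)
    show "decidable (Suc k) (\<lambda>A ys. \<exists>x<Suc (F A (tl ys)). F A (tl ys) = prod_encode (x, hd ys))"
      by (rule decidable_ex_less)
         (rule recursive_intros recursive_prod_encode recursive_comp[OF assms])+
  qed (simp add: eq)
  then show ?thesis by (simp add: eq Least_equality)
qed

lemma recursive_initial_segment: "recursive 1 (\<lambda>A xs. string_code (initial_segment A (hd xs)))"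
proof -
  \<comment> \<open>List codes grow at the head, so the recursion prepends the bits from the last one backwards.\<close>
  let ?g = "\<lambda>A n. rec_nat 0 (\<lambda>j y. Suc (prod_encode (char_fun A (n - Suc j), y)))"
  have eq: "?g A n j = list_encode (map (char_fun A) [n - j..<n])" if "j \<le> n" for A n j
    using that
  proof (induction j)
    case (Suc j)
    then have "[n - Suc j..<n] = (n - Suc j) # [n - j..<n]"
      by (simp add: upt_conv_Cons Suc_diff_Suc)
    then show ?case using Suc by simp
  qed simp
  have "string_code (initial_segment A n) = ?g A n n" for A n
    unfolding eq[OF order_refl]
    by (simp add: string_code_def initial_segment_def comp_def flip: char_fun_eq_of_bool)
  moreover have "recursive 1 (\<lambda>A xs. ?g A (hd xs) (hd xs))"
    unfolding One_nat_def
    by (rule recursive_rec_nat)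
       (rule recursive_oracle recursive_prod_encode recursive_intros)+
  ultimately show ?thesis by simp
qed

section \<open>Relative computability\<close>

text \<open>Replaces every oracle query in a code by a call of the code \<open>e\<close>.\<close>
primrec subst_oracle :: "recf \<Rightarrow> recf \<Rightarrow> recf" where
  "subst_oracle e Zero = Zero"
| "subst_oracle e Succ = Succ"
| "subst_oracle e (Proj i) = Proj i"
| "subst_oracle e Oracle = e"
| "subst_oracle e (Comp f gs) = Comp (subst_oracle e f) (map (subst_oracle e) gs)"
| "subst_oracle e (Prim f g) = Prim (subst_oracle e f) (subst_oracle e g)"
| "subst_oracle e (Mu f) = Mu (subst_oracle e f)"

lemma computes_subst_oracle:
  assumes "computes B c xs y" and e: "\<And>x. computes A e [x] (char_fun B x)"
  shows "computes A (subst_oracle e c) xs y"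
  using assms(1)
proof (induction rule: computes.induct)
  case (Comp xs gs ys f z)
  then show ?case
    by (auto simp: list_all2_conv_all_nth intro!: computes.Comp[where ys = ys])
next
  case (Mu f n xs)
  then show ?case by (auto intro!: computes.Mu)
qed (auto intro: computes.intros e)

lemma turing_le_trans: "X \<le>\<^sub>T B \<Longrightarrow> B \<le>\<^sub>T A \<Longrightarrow> X \<le>\<^sub>T A"
  unfolding turing_le_def using computes_subst_oracle by meson

lemma turing_leI:
  assumes "decidable 1 (\<lambda>A xs. P A (hd xs))"
  shows "{x. P A x} \<le>\<^sub>T A"
proof -
  obtain c where c: "\<And>xs. length xs = 1 \<Longrightarrow> computes A c xs (of_bool (P A (hd xs)))"
    using assms unfolding decidable_def recursive_def by blast
  have "computes A c [x] (char_fun {x. P A x} x)" for x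
    using c[of "[x]"] by (simp add: char_fun_def of_bool_def)
  then show ?thesis unfolding turing_le_def by blast
qed

text \<open>
  A computation from the empty oracle becomes independent of the oracle when its queries are
  answered by the code \<open>Zero\<close>.
\<close>
lemma computable_decidable:
  assumes "computable X"
  shows "decidable 1 (\<lambda>A xs. hd xs \<in> X)"
proof -
  obtain c where c: "\<And>x. computes {} c [x] (char_fun X x)"
    using assms unfolding computable_def turing_le_def by blast
  have "computes A (subst_oracle Zero c) [x] (char_fun X x)" for A x
    by (rule computes_subst_oracle[OF c]) (simp add: char_fun_def computes.Zero)
  then show ?thesis
    unfolding decidable_def recursive_def
    by (intro exI[of _ "subst_oracle Zero c"]) (auto simp: length_Suc_conv simp flip: char_fun_eq_of_bool)
qed

lemma infinite_join_constant_turing_le: "infinite_join (\<lambda>_. A) \<le>\<^sub>T A"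
proof -
  have eq: "infinite_join (\<lambda>_. A) = {z. char_fun A (snd (prod_decode z)) = 1}"
    unfolding infinite_join_def char_fun_def
    by (auto simp: split: if_splits) (metis prod.collapse prod_decode_inverse)
  show ?thesis
    unfolding eq One_nat_def
    by (rule turing_leI)
       (unfold One_nat_def, (rule recursive_intros recursive_oracle recursive_snd_prod_decode)+)
qed

section \<open>Bounded approximations of computations\<close>

text \<open>
  The approximation by \<open>n\<close> to the computation of a code with oracle \<open>B\<close>: \<open>Suc y\<close> stands for the
  value \<open>y\<close>, and \<open>0\<close> for no value. It gives no value if the arguments do not fit the code, a query
  \<open>\<ge> n\<close> is made, or an unbounded search has no result \<open>< n\<close>. Primitive recursions are carried out in full, so no step count is needed.
  In the clause for \<open>Mu\<close>, the value \<open>1\<close> means that a zero is found, and \<open>0\<close> that the search is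
  stuck.
\<close>
fun approx :: "nat \<Rightarrow> nat set \<Rightarrow> recf \<Rightarrow> nat list \<Rightarrow> nat" where
  "approx n B Zero xs = 1"
| "approx n B Succ xs = (if length xs = 1 then Suc (Suc (hd xs)) else 0)"
| "approx n B (Proj i) xs = (if i < length xs then Suc (xs ! i) else 0)"
| "approx n B Oracle xs =
     (if length xs = 1 \<and> hd xs < n then Suc (of_bool (hd xs \<in> B)) else 0)"
| "approx n B (Comp f gs) xs =
     (if \<exists>g\<in>set gs. approx n B g xs = 0 then 0
      else approx n B f (map (\<lambda>g. approx n B g xs - 1) gs))"
| "approx n B (Prim f g) xs =
     (if xs = [] then 0
      else rec_nat (approx n B f (tl xs))
        (\<lambda>m y. if y = 0 then 0 else approx n B g (m # (y - 1) # tl xs)) (hd xs))"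
| "approx n B (Mu f) xs =
     (let m = LEAST m. n \<le> m \<or> approx n B f (m # xs) \<le> 1
      in if m < n \<and> approx n B f (m # xs) = 1 then Suc m else 0)"

text \<open>Values are correct for every oracle \<open>A\<close> that agrees with \<open>B\<close> below \<open>n\<close>.\<close>
lemma approx_sound:
  assumes "approx n B c xs = Suc y" and "\<And>q. q < n \<Longrightarrow> q \<in> A \<longleftrightarrow> q \<in> B"
  shows "computes A c xs y"
  using assms
proof (induction n B c xs arbitrary: y rule: approx.induct)
  case (1 n B xs)
  then show ?case by (simp add: computes.Zero)
next
  case (2 n B xs)
  then show ?case by (auto split: if_splits simp: length_Suc_conv intro: computes.Succ)
next
  case (3 n B i xs)
  then show ?case by (auto split: if_splits intro: computes.Proj)
next
  case (4 n B xs)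
  then obtain x where "xs = [x]" "x < n" "y = of_bool (x \<in> B)"
    by (auto split: if_splits simp: length_Suc_conv)
  then show ?case
    using 4(2) computes.Oracle[of A x] by (simp add: char_fun_eq_of_bool)
next
  case (5 n B f gs xs)
  have "\<forall>g\<in>set gs. approx n B g xs \<noteq> 0"
    using "5.prems"(1) by (auto split: if_splits)
  then have pos: "approx n B g xs = Suc (approx n B g xs - 1)" if "g \<in> set gs" for g
    using that by fastforce
  have "computes A g xs (approx n B g xs - 1)" if "g \<in> set gs" for g
    using "5.IH"(1)[OF that pos[OF that] "5.prems"(2)] by blast
  moreover have "computes A f (map (\<lambda>g. approx n B g xs - 1) gs) y"
    using "5.IH"(3)[OF _ _ "5.prems"(2)] "5.prems"(1) by (auto split: if_splits)
  ultimately show ?case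
    by (intro computes.Comp[where ys = "map (\<lambda>g. approx n B g xs - 1) gs"])
       (auto simp: list_all2_conv_all_nth)
next
  case (6 n B f g xs)
  let ?h = "rec_nat (approx n B f (tl xs))
        (\<lambda>m y. if y = 0 then 0 else approx n B g (m # (y - 1) # tl xs))"
  have ne: "xs \<noteq> []" and h: "?h (hd xs) = Suc y"
    using 6(3) by (auto split: if_splits)
  have "computes A (Prim f g) (m # tl xs) z" if "?h m = Suc z" for m z
    using that
  proof (induction m arbitrary: z)
    case 0
    then show ?case using 6(1)[OF ne _ 6(4)] by (simp add: computes.Prim_0)
  next
    case (Suc m)
    then have nz: "?h m \<noteq> 0" and z: "approx n B g (m # (?h m - 1) # tl xs) = Suc z"
      by (auto split: if_splits)
    from nz have "computes A (Prim f g) (m # tl xs) (?h m - 1)" by (intro Suc.IH) simp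
    moreover have "computes A g (m # (?h m - 1) # tl xs) z"
      using 6(2)[OF ne nz z 6(4)] .
    ultimately show ?case by (rule computes.Prim_Suc)
  qed
  from this[OF h] show ?case using ne by simp
next
  case (7 n B f xs)
  define m where "m = (LEAST m. n \<le> m \<or> approx n B f (m # xs) \<le> 1)"
  have m: "m < n" "approx n B f (m # xs) = 1" "y = m"
    using "7.prems"(1) by (auto simp: m_def Let_def split: if_splits)
  have "\<exists>k. computes A f (j # xs) (Suc k)" if "j < m" for j
  proof -
    have "\<not> (n \<le> j \<or> approx n B f (j # xs) \<le> 1)"
      using that unfolding m_def by (rule not_less_Least)
    then have "approx n B f (j # xs) = Suc (Suc (approx n B f (j # xs) - 2))" by linarith
    from "7.IH"(1)[OF this "7.prems"(2)] show ?thesis by blast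
  qed
  moreover have "computes A f (m # xs) 0"
    using "7.IH"(1)[of m 0] "7.prems"(2) m by simp
  ultimately show ?case unfolding m(3) by (intro computes.Mu)
qed

text \<open>
  The use principle in the form of continuity: a value computed from \<open>A\<close> is eventually found if
  the oracles \<open>B j\<close> converge to \<open>A\<close> pointwise and the bounds \<open>n j\<close> tend to infinity.
\<close>
lemma approx_complete:
  fixes B :: "'i \<Rightarrow> nat set" and n :: "'i \<Rightarrow> nat"
  assumes "computes A c xs y"
    and n: "filterlim n at_top F"
    and B: "\<And>q. \<forall>\<^sub>F j in F. q \<in> B j \<longleftrightarrow> q \<in> A"
  shows "\<forall>\<^sub>F j in F. approx (n j) (B j) c xs = Suc y"
  using assms(1)
proof (induction rule: computes.induct)
  case (Oracle x)
  have "\<forall>\<^sub>F j in F. x < n j" using n by (auto simp: filterlim_at_top simp flip: Suc_le_eq)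
  then show ?case using B[of x]
    by eventually_elim (simp add: char_fun_eq_of_bool)
next
  case (Comp xs gs ys f z)
  have "\<forall>\<^sub>F j in F. \<forall>i\<in>{..<length gs}. approx (n j) (B j) (gs ! i) xs = Suc (ys ! i)"
    using Comp.IH(1) by (intro eventually_ball_finite) (auto simp: list_all2_conv_all_nth)
  then show ?case using Comp.IH(2)
  proof eventually_elim
    case (elim j)
    have len: "length ys = length gs" using Comp.IH(1) by (simp add: list_all2_conv_all_nth)
    have "map (\<lambda>g. approx (n j) (B j) g xs - 1) gs = ys"
      using elim(1) len by (intro nth_equalityI) auto
    moreover have "\<forall>g\<in>set gs. approx (n j) (B j) g xs \<noteq> 0"
      using elim(1) by (auto simp: in_set_conv_nth)
    ultimately show ?case using elim(2) by simp
  qed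
next
  case (Prim_Suc f g m xs y z)
  from Prim_Suc.IH show ?case by eventually_elim (simp cong: if_cong)
next
  case (Mu f m xs)
  have "\<forall>\<^sub>F j in F. \<forall>i\<in>{..<m}. approx (n j) (B j) f (i # xs) > 1"
  proof (intro eventually_ball_finite ballI)
    fix i assume "i \<in> {..<m}"
    then obtain k where "\<forall>\<^sub>F j in F. approx (n j) (B j) f (i # xs) = Suc (Suc k)"
      using Mu.IH(2) by auto
    then show "\<forall>\<^sub>F j in F. approx (n j) (B j) f (i # xs) > 1" by eventually_elim simp
  qed simp
  moreover have "\<forall>\<^sub>F j in F. m < n j" using n by (auto simp: filterlim_at_top simp flip: Suc_le_eq)
  ultimately show ?case using Mu.IH(1)
  proof eventually_elim
    case (elim j)
    have "(LEAST i. n j \<le> i \<or> approx (n j) (B j) f (i # xs) \<le> 1) = m"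
    proof (rule Least_equality)
      fix i assume i: "n j \<le> i \<or> approx (n j) (B j) f (i # xs) \<le> 1"
      show "m \<le> i"
      proof (rule ccontr)
        assume "\<not> m \<le> i"
        then have "i \<in> {..<m}" by simp
        with elim(1) have "approx (n j) (B j) f (i # xs) > 1" by blast
        then show False using i elim(2) \<open>\<not> m \<le> i\<close> by linarith
      qed
    qed (use elim in simp)
    then show ?case using elim by simp
  qed
qed simp_all

text \<open>
  For a fixed code the approximation is recursive in \<open>n\<close>, in the canonical index of a finite oracle
  and in the arguments. The index is a number, so that one can quantify over finite oracles.
\<close>
lemma recursive_approx:
  "recursive (Suc (Suc k)) (\<lambda>A xs. approx (hd xs) (set_decode (hd (tl xs))) c (tl (tl xs)))"
proof (induction c arbitrary: k)
  case Zero
  show ?case by (simp add: recursive_const)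
next
  case Succ
  have "recursive (Suc (Suc k)) (\<lambda>A xs. if k = 1 then Suc (Suc (hd (tl (tl xs)))) else 0)"
  proof (cases "k = 1")
    case True
    show ?thesis unfolding True One_nat_def by (simp, (rule recursive_intros)+)
  next
    case False
    then show ?thesis by (simp add: recursive_const)
  qed
  then show ?case by (rule recursive_cong) auto
next
  case (Proj i)
  have "recursive (Suc (Suc k)) (\<lambda>A xs. if i < k then Suc (xs ! Suc (Suc i)) else 0)"
    by (cases "i < k") (simp_all add: recursive_const recursive_Suc recursive_nth)
  then show ?case by (rule recursive_cong) (auto simp: nth_tl)
next
  case Oracle
  have "recursive (Suc (Suc k)) (\<lambda>A xs. if k = 1 then if hd (tl (tl xs)) < hd xs
     then Suc (of_bool (hd (tl (tl xs)) \<in> set_decode (hd (tl xs)))) else 0 else 0)"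
  proof (cases "k = 1")
    case True
    show ?thesis unfolding True One_nat_def
      by (simp, (rule recursive_intros decidable_in_set_decode[unfolded decidable_def])+)
  next
    case False
    then show ?thesis by (simp add: recursive_const)
  qed
  then show ?case by (rule recursive_cong) auto
next
  case (Comp f gs)
  let ?L = "\<lambda>xs. map (\<lambda>g. approx (hd xs) (set_decode (hd (tl xs))) g (tl (tl xs)) - 1) gs"
  have "recursive_vec (Suc (Suc k)) (length gs) (\<lambda>A xs. ?L xs)"
    unfolding recursive_vec_def using recursive_pred[OF Comp.IH(2)] by simp
  then have "recursive_vec (Suc (Suc k)) (Suc (Suc (length gs))) (\<lambda>A xs. hd xs # hd (tl xs) # ?L xs)"
    by - (rule recursive_intros | assumption)+
  from recursive_comp[OF Comp.IH(1) this]
  have f: "recursive (Suc (Suc k))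
      (\<lambda>A xs. approx (hd xs) (set_decode (hd (tl xs))) f (?L xs))" by simp
  have "decidable (Suc (Suc k))
      (\<lambda>A xs. \<exists>g\<in>set gs. approx (hd xs) (set_decode (hd (tl xs))) g (tl (tl xs)) = 0)"
    by (rule decidable_Bex_set) (rule decidable_eq recursive_const Comp.IH | assumption)+
  from recursive_If[OF this recursive_const f] show ?case by simp
next
  case (Prim f g)
  show ?case
  proof (cases k)
    case 0
    have "recursive (Suc (Suc k)) (\<lambda>A xs. 0)" by (rule recursive_const)
    then show ?thesis by (rule recursive_cong) (auto simp: 0 length_Suc_conv)
  next
    case (Suc l)
    let ?F = "\<lambda>xs. approx (hd xs) (set_decode (hd (tl xs))) f (tl (tl (tl xs)))"
    let ?G = "\<lambda>m y xs. approx (hd xs) (set_decode (hd (tl xs))) g (m # (y - 1) # tl (tl (tl xs)))"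
    have "recursive_vec (Suc (Suc k)) (Suc (Suc l)) (\<lambda>A xs. hd xs # hd (tl xs) # tl (tl (tl xs)))"
      unfolding Suc by (rule recursive_intros)+
    from recursive_comp[OF Prim.IH(1) this]
    have F: "recursive (Suc (Suc k)) (\<lambda>A xs. ?F xs)" by simp
    have "recursive_vec (Suc (Suc (Suc (Suc k)))) (Suc (Suc (Suc (Suc l))))
        (\<lambda>A ys. hd (tl (tl ys)) # hd (tl (tl (tl ys))) # hd ys # (hd (tl ys) - 1) #
           tl (tl (tl (tl (tl ys)))))"
      unfolding Suc by (rule recursive_intros)+
    from recursive_comp[OF Prim.IH(2) this]
    have G: "recursive (Suc (Suc (Suc (Suc k))))
        (\<lambda>A ys. ?G (hd ys) (hd (tl ys)) (tl (tl ys)))" by simp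
    have "recursive (Suc (Suc k))
        (\<lambda>A xs. rec_nat (?F xs) (\<lambda>m y. if y = 0 then 0 else ?G m y xs) (hd (tl (tl xs))))"
    proof (rule recursive_rec_nat[OF _ F])
      show "recursive (Suc (Suc k)) (\<lambda>A xs. hd (tl (tl xs)))"
        unfolding Suc by (rule recursive_intros)+
      show "recursive (Suc (Suc (Suc (Suc k))))
          (\<lambda>A ys. if hd (tl ys) = 0 then 0 else ?G (hd ys) (hd (tl ys)) (tl (tl ys)))"
        by (rule recursive_If[OF _ recursive_const G]) (rule recursive_intros)+
    qed
    then show ?thesis by (rule recursive_cong) (auto simp: Suc length_Suc_conv)
  qed
next
  case (Mu f)
  let ?H = "\<lambda>m xs. approx (hd xs) (set_decode (hd (tl xs))) f (m # tl (tl xs))"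
  have H: "recursive j (\<lambda>A xs. ?H (M A xs) (L A xs))"
    if "recursive j M" "recursive_vec j (Suc (Suc k)) L" for j M L
  proof -
    have "recursive_vec j (Suc (Suc (Suc k)))
        (\<lambda>A xs. hd (L A xs) # hd (tl (L A xs)) # M A xs # tl (tl (L A xs)))"
      by (rule recursive_intros that)+
    from recursive_comp[OF Mu.IH this] show ?thesis by simp
  qed
  let ?m = "\<lambda>xs. LEAST m. hd xs \<le> m \<or> ?H m xs \<le> 1"
  have m: "recursive (Suc (Suc k)) (\<lambda>A xs. ?m xs)"
    by (rule recursive_Least) ((rule recursive_intros H)+, blast)
  have "recursive (Suc (Suc k)) (\<lambda>A xs.
      if ?m xs < hd xs \<and> ?H (?m xs) xs = 1 then Suc (?m xs) else 0)"
    by (rule m H recursive_intros)+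
  then show ?case unfolding approx.simps Let_def .
qed

section \<open>Compactness of Cantor space\<close>

text \<open>Sequential compactness of Cantor space, where convergence is pointwise.\<close>
lemma convergent_subsequence_sets:
  fixes B :: "nat \<Rightarrow> nat set"
  obtains r A where "strict_mono (r :: nat \<Rightarrow> nat)"
    "\<And>q. \<forall>\<^sub>F j in sequentially. q \<in> B (r j) \<longleftrightarrow> q \<in> A"
proof -
  interpret subseqs "\<lambda>q s. \<exists>b. \<forall>\<^sub>F j in sequentially. (q \<in> B (s j)) = b"
  proof
    fix q :: nat and s :: "nat \<Rightarrow> nat" assume "strict_mono s"
    have "(UNIV :: nat set) = {j. (q \<in> B (s j)) = True} \<union> {j. (q \<in> B (s j)) = False}" by auto
    then have "infinite {j. (q \<in> B (s j)) = True} \<or> infinite {j. (q \<in> B (s j)) = False}"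
      by (metis finite_Un infinite_UNIV_nat)
    then obtain b where "infinite {j. (q \<in> B (s j)) = b}" by (elim disjE)
    from infinite_enumerate[OF this] obtain r :: "nat \<Rightarrow> nat"
      where "strict_mono r" "\<forall>j. r j \<in> {j. (q \<in> B (s j)) = b}" by (elim exE conjE)
    then have "strict_mono r" "\<forall>\<^sub>F j in sequentially. (q \<in> B ((s \<circ> r) j)) = b"
      by simp_all
    then show "\<exists>r. strict_mono r \<and> (\<exists>b. \<forall>\<^sub>F j in sequentially. (q \<in> B ((s \<circ> r) j)) = b)"
      by (intro exI conjI)
  qed
  have "\<exists>b. \<forall>\<^sub>F j in sequentially. (q \<in> B (diagseq j)) = b" for q
  proof -
    have "\<exists>b. \<forall>\<^sub>F j in sequentially. (q \<in> B ((diagseq \<circ> (+) (Suc q)) j)) = b"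
    proof (rule diagseq_holds[of q])
      fix n :: nat and s r :: "nat \<Rightarrow> nat"
      assume r: "strict_mono r" and ev: "\<exists>b. \<forall>\<^sub>F j in sequentially. (n \<in> B (s j)) = b"
      from ev obtain b where "\<forall>\<^sub>F j in sequentially. (n \<in> B (s j)) = b" by (rule exE)
      from eventually_subseq[OF r this]
      have "\<forall>\<^sub>F j in sequentially. (n \<in> B ((s \<circ> r) j)) = b" by (simp only: comp_apply)
      then show "\<exists>b. \<forall>\<^sub>F j in sequentially. (n \<in> B ((s \<circ> r) j)) = b" by (rule exI)
    qed
    then obtain b where "\<forall>\<^sub>F j in sequentially. (q \<in> B ((diagseq \<circ> (+) (Suc q)) j)) = b"
      by (rule exE)
    then have "\<forall>\<^sub>F j in sequentially. (q \<in> B (diagseq (j + Suc q))) = b"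
      by (simp only: comp_apply add.commute[of "Suc q"])
    then have "\<forall>\<^sub>F j in sequentially. (q \<in> B (diagseq j)) = b"
      by (rule eventually_sequentially_seg[THEN iffD1])
    then show ?thesis by (rule exI)
  qed
  then have "\<exists>b. \<forall>q. \<forall>\<^sub>F j in sequentially. (q \<in> B (diagseq j)) = b q"
    by (intro choice allI)
  then obtain b where b: "\<forall>q. \<forall>\<^sub>F j in sequentially. (q \<in> B (diagseq j)) = b q" by (rule exE)
  show thesis
    by (rule that[of diagseq "{q. b q}"]) (use b subseq_diagseq in simp_all)
qed

section \<open>The forcing argument\<close>

text \<open>
  The class of the oracles on which no code in \<open>D\<close>, run without arguments, halts. For finite \<open>D\<close>
  these are the \<open>\<Pi>\<^sup>0\<^sub>1\<close> classes; a code that halts on \<open>A\<close> witnesses that \<open>A\<close> lies outside.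
\<close>
definition avoiding :: "recf set \<Rightarrow> nat set set" where
  "avoiding D = {A. \<forall>d\<in>D. \<forall>y. \<not> computes A d [] y}"

text \<open>The compactness step: the classes of an increasing sequence of conditions have a common member.\<close>
lemma avoiding_limit:
  assumes "\<And>j. D j \<subseteq> D (Suc j)" and "\<And>j. avoiding (D j) \<noteq> {}"
  shows "avoiding (\<Union>j. D j) \<noteq> {}"
proof -
  have "\<forall>j. \<exists>B. B \<in> avoiding (D j)" using assms(2) by blast
  then obtain B where B: "\<And>j. B j \<in> avoiding (D j)" by metis
  obtain r A where r: "strict_mono r" and lim: "\<And>q. \<forall>\<^sub>F j in sequentially. q \<in> B (r j) \<longleftrightarrow> q \<in> A"
    using convergent_subsequence_sets[of B] by blast
  have "\<not> computes A d [] y" if "d \<in> D i" for d i y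
  proof
    assume "computes A d [] y"
    then have "\<forall>\<^sub>F j in sequentially. approx j (B (r j)) d [] = Suc y"
      by (rule approx_complete) (use lim in \<open>auto simp: filterlim_ident\<close>)
    then have "\<forall>\<^sub>F j in sequentially. i \<le> j \<and> approx j (B (r j)) d [] = Suc y"
      using eventually_ge_at_top[of i] by eventually_elim simp
    then obtain j where j: "i \<le> j" "approx j (B (r j)) d [] = Suc y"
      using eventually_happens[of _ sequentially] by auto
    have "computes (B (r j)) d [] y" using approx_sound[OF j(2)] by blast
    moreover have "d \<in> D (r j)"
      using that j(1) lift_Suc_mono_le[of D, OF assms(1)] seq_suble[OF r, of j]
      by (meson order_trans subsetD)
    ultimately show False using B[of "r j"] unfolding avoiding_def by blast
  qed
  then have "A \<in> avoiding (\<Union>j. D j)" unfolding avoiding_def by blast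
  then show ?thesis by blast
qed

text \<open>A set computed by a single code from all members of a non-empty class is computable.\<close>
lemma computable_if_computed_on_avoiding:
  assumes D: "finite D" "avoiding D \<noteq> {}"
    and c: "\<And>A x. A \<in> avoiding D \<Longrightarrow> computes A c [x] (char_fun X x)"
  shows "computable X"
proof -
  \<comment> \<open>\<open>n\<close> certifies that every member of the class yields the value \<open>y\<close> at \<open>x\<close>; the numbers \<open>a < 2^n\<close>
    are the canonical indices of the subsets of \<open>{..<n}\<close>.\<close>
  define good where "good n x y \<longleftrightarrow> (\<forall>a<2 ^ n.
      (\<exists>d\<in>D. approx n (set_decode a) d [] \<noteq> 0) \<or> approx n (set_decode a) c [x] = Suc y)" for n x y
  have good_unique: "y = char_fun X x" if good: "good n x y" for n x y
  proof -
    obtain A where A: "A \<in> avoiding D" using D(2) by blast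
    \<comment> \<open>For the restriction of a member \<open>A\<close>, no code in \<open>D\<close> is seen to halt, so \<open>c\<close> outputs \<open>y\<close>.\<close>
    define a where "a = set_encode (A \<inter> {..<n})"
    have a: "set_decode a = A \<inter> {..<n}" by (simp add: a_def)
    have "a \<le> set_encode {..<n}"
      unfolding a_def set_encode_def by (rule sum_mono2) auto
    also have "\<dots> < 2 ^ n"
      by (simp add: set_encode_def sum_power2 flip: atLeast0LessThan)
    finally have "a < 2 ^ n" .
    have sound: "approx n (set_decode a) e xs = Suc z \<Longrightarrow> computes A e xs z" for e xs z
      by (erule approx_sound) (simp add: a)
    have "approx n (set_decode a) d [] = 0" if "d \<in> D" for d
      using sound[of d "[]"] A that not0_implies_Suc unfolding avoiding_def by blast
    then have "approx n (set_decode a) c [x] = Suc y"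
      using good \<open>a < 2 ^ n\<close> unfolding good_def by auto
    from sound[OF this] c[OF A] show ?thesis by (rule computes_deterministic)
  qed
  have good_ex: "\<exists>n. good n x (char_fun X x)" for x
  proof (rule ccontr)
    assume "\<nexists>n. good n x (char_fun X x)"
    \<comment> \<open>Counterexamples \<open>a n\<close> for all \<open>n\<close> accumulate at an oracle of the class on which \<open>c\<close> fails.\<close>
    then obtain a where a: "\<And>n d. d \<in> D \<Longrightarrow> approx n (set_decode (a n)) d [] = 0"
      "\<And>n. approx n (set_decode (a n)) c [x] \<noteq> Suc (char_fun X x)"
      unfolding good_def by metis
    obtain r A where r: "strict_mono r"
      and lim: "\<And>q. \<forall>\<^sub>F j in sequentially. q \<in> set_decode (a (r j)) \<longleftrightarrow> q \<in> A"
      using convergent_subsequence_sets[of "\<lambda>n. set_decode (a n)"] by blast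
    have complete: "\<exists>j. approx (r j) (set_decode (a (r j))) e xs = Suc y"
      if "computes A e xs y" for e xs y
      using approx_complete[OF that filterlim_subseq[OF r] lim]
        eventually_happens[of _ sequentially] by auto
    have "A \<in> avoiding D"
      unfolding avoiding_def using complete a(1) by fastforce
    from complete[OF c[OF this]] a(2) show False by blast
  qed
  obtain ds where ds: "set ds = D" using D(1) finite_list by blast
  have good_dec2: "decidable 2 (\<lambda>A xs. good (hd xs) (hd (tl xs)) y)" for y
  proof -
    have *: "decidable 2 (\<lambda>A xs. \<forall>a<2 ^ hd xs.
      (\<exists>d\<in>set ds. approx (hd xs) (set_decode a) d [] \<noteq> 0) \<or>
      approx (hd xs) (set_decode a) c [hd (tl xs)] = Suc y)"
    proof (rule decidable_all_less)
      have L: "recursive_vec 3 2 (\<lambda>A xs. [hd (tl xs), hd xs])"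
        "recursive_vec 3 (Suc (Suc 1)) (\<lambda>A xs. [hd (tl xs), hd xs, hd (tl (tl xs))])"
        by (simp_all add: eval_nat_numeral, (rule recursive_intros)+)
      have "recursive 3 (\<lambda>A xs. approx (hd (tl xs)) (set_decode (hd xs)) d [])" for d
        using recursive_comp[OF recursive_approx[of 0 d], of 3, OF L(1)[unfolded numeral_2_eq_2]]
        by simp
      moreover have "recursive 3 (\<lambda>A xs. approx (hd (tl xs)) (set_decode (hd xs)) c [hd (tl (tl xs))])"
        using recursive_comp[OF recursive_approx[of 1 c], of 3, OF L(2)]
        by simp
      ultimately show "decidable (Suc 2) (\<lambda>A ys.
         (\<exists>d\<in>set ds. approx (hd (tl ys)) (set_decode (hd ys)) d [] \<noteq> 0) \<or>
         approx (hd (tl ys)) (set_decode (hd ys)) c [hd (tl (tl ys))] = Suc y)"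
        by (intro decidable_disj decidable_Bex_set decidable_not decidable_eq recursive_const)
           (simp_all add: eval_nat_numeral)
      have "recursive 2 (\<lambda>A xs. hd xs)"
        unfolding numeral_2_eq_2 by (rule recursive_intros)+
      then show "recursive 2 (\<lambda>A xs. 2 ^ hd xs)" by (rule recursive_pow2)
    qed
    then show ?thesis unfolding good_def ds by simp
  qed
  have good_dec: "decidable k (\<lambda>A xs. good (N A xs) (M A xs) y)"
    if "recursive k N" "recursive k M" for k N M y
  proof -
    have "recursive_vec k 2 (\<lambda>A xs. [N A xs, M A xs])"
      unfolding numeral_2_eq_2 by (rule that recursive_vec_intros)+
    from recursive_comp[OF good_dec2[of y, unfolded decidable_def] this] show ?thesis
      by (simp add: decidable_def)
  qed
  \<comment> \<open>The search for either value always ends, and the value that it certifies is correct.\<close>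
  let ?N = "\<lambda>x. LEAST n. good n x 0 \<or> good n x 1"
  have ex: "\<exists>n. good n x 0 \<or> good n x 1" for x
    using good_ex[of x] by (auto simp: char_fun_def split: if_splits)
  have "decidable 1 (\<lambda>A xs. good (?N (hd xs)) (hd xs) 1)"
    unfolding One_nat_def
    by (rule good_dec recursive_Least recursive_intros ex[unfolded One_nat_def])+
  then have "{x. good (?N x) x 1} \<le>\<^sub>T {}" by (rule turing_leI)
  moreover have "good (?N x) x 1 \<longleftrightarrow> x \<in> X" for x
  proof -
    define n where "n = ?N x"
    have "good n x 0 \<or> good n x 1" unfolding n_def using ex by (rule LeastI_ex)
    moreover have "good n x 0 \<Longrightarrow> x \<notin> X" "good n x 1 \<Longrightarrow> x \<in> X"
      using good_unique[of n x 0] good_unique[of n x 1]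
      by (simp_all add: char_fun_def split: if_splits)
    ultimately show ?thesis unfolding n_def by blast
  qed
  ultimately show ?thesis unfolding computable_def by simp
qed

text \<open>
  The code \<open>d\<close> searches for a zero of a function that is constantly \<open>0\<close> if \<open>c\<close> outputs \<open>y\<close>,
  constantly \<open>1\<close> if \<open>c\<close> outputs another value, and undefined if \<open>c\<close> diverges.
\<close>
lemma code_halting_iff_output:
  obtains d where "\<And>A. (\<exists>z. computes A d [] z) \<longleftrightarrow> computes A c [x] y"
proof -
  have "recursive 1 (\<lambda>A xs. if hd xs = y then 0 else 1)"
    unfolding One_nat_def by (rule recursive_intros)+
  then obtain e where "\<And>A xs. length xs = 1 \<Longrightarrow> computes A e xs (if hd xs = y then 0 else 1)"
    unfolding recursive_def by blast
  then have e: "computes A e [v] (if v = y then 0 else 1)" for A v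
    by (metis length_Cons list.sel(1) list.size(3) One_nat_def)
  obtain k where k: "\<And>A xs. length xs = 1 \<Longrightarrow> computes A k xs x"
    using recursive_const[of 1 x] unfolding recursive_def by blast
  let ?f = "Comp e [Comp c [k]]"
  show thesis
  proof (rule that[of "Mu ?f"], rule iffI)
    fix A assume "\<exists>z. computes A (Mu ?f) [] z"
    then obtain z where "computes A ?f [z] 0" by (auto elim: computes.cases)
    then obtain v where "computes A (Comp c [k]) [z] v" and v: "computes A e [v] 0"
      by cases (auto simp: list_all2_Cons1)
    then obtain u where "computes A k [z] u" and u: "computes A c [u] v"
      by (auto elim!: computes.cases[of A "Comp c [k]"] simp: list_all2_Cons1)
    then have "u = x" using k[of "[z]" A] computes_deterministic by simp
    moreover have "v = y" using computes_deterministic[OF v e] by (simp split: if_splits)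
    ultimately show "computes A c [x] y" using u by simp
  next
    fix A assume "computes A c [x] y"
    then have "computes A (Comp c [k]) [0] y"
      by (intro computes.Comp[where ys = "[x]"]) (auto intro: k)
    then have "computes A ?f [0] 0"
      using e[of A y] by (intro computes.Comp[where ys = "[y]"]) auto
    then have "computes A (Mu ?f) [] 0" by (auto intro: computes.Mu)
    then show "\<exists>z. computes A (Mu ?f) [] z" by blast
  qed
qed

text \<open>The code \<open>d\<close> searches for an initial segment of the oracle that is not in the tree.\<close>
lemma Pi01_class_avoiding:
  assumes "Pi01_class P"
  obtains d where "P = avoiding {d}"
proof -
  obtain \<Lambda> where \<Lambda>: "computable_strings \<Lambda>" "P = paths \<Lambda>"
    using assms unfolding Pi01_class_def by blast
  have "inj string_code"
  proof (rule injI)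
    fix \<sigma> \<tau> assume "string_code \<sigma> = string_code \<tau>"
    then have "map of_bool \<sigma> = (map of_bool \<tau> :: nat list)"
      by (simp add: string_code_def list_encode_eq)
    then show "\<sigma> = \<tau>" by (rule map_injective) (simp add: inj_def)
  qed
  moreover have "decidable 1 (\<lambda>A xs. string_code (initial_segment A (hd xs)) \<in> string_code ` \<Lambda>)"
    unfolding decidable_def
    using recursive_comp[OF computable_decidable[unfolded decidable_def], of _ 1
        "\<lambda>A xs. [string_code (initial_segment A (hd xs))]"] \<Lambda>(1)
      recursive_vec_Cons[OF recursive_initial_segment recursive_vec_Nil]
    by (simp add: computable_strings_def)
  ultimately have "decidable 1 (\<lambda>A xs. initial_segment A (hd xs) \<in> \<Lambda>)"
    by (simp add: inj_image_mem_iff)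
  then obtain e where "\<And>A xs. length xs = 1 \<Longrightarrow>
      computes A e xs (of_bool (initial_segment A (hd xs) \<in> \<Lambda>))"
    unfolding decidable_def recursive_def by blast
  then have e: "computes A e [n] (of_bool (initial_segment A n \<in> \<Lambda>))" for A n
    by (metis length_Cons list.sel(1) list.size(3) One_nat_def)
  have "(\<exists>z. computes A (Mu e) [] z) \<longleftrightarrow> (\<exists>n. initial_segment A n \<notin> \<Lambda>)" for A
  proof
    assume "\<exists>z. computes A (Mu e) [] z"
    then obtain z where "computes A e [z] 0" by (auto elim: computes.cases)
    from computes_deterministic[OF this e] show "\<exists>n. initial_segment A n \<notin> \<Lambda>" by auto
  next
    assume ex: "\<exists>n. initial_segment A n \<notin> \<Lambda>"
    define n where "n = (LEAST n. initial_segment A n \<notin> \<Lambda>)"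
    have "computes A (Mu e) [] n"
    proof (rule computes.Mu)
      have "initial_segment A n \<notin> \<Lambda>" unfolding n_def using ex by (rule LeastI_ex)
      then show "computes A e [n] 0" using e[of A n] by simp
      fix m assume "m < n"
      then have "initial_segment A m \<in> \<Lambda>" unfolding n_def using not_less_Least by blast
      then show "\<exists>k. computes A e [m] (Suc k)" using e[of A m] by auto
    qed
    then show "\<exists>z. computes A (Mu e) [] z" by blast
  qed
  then have "P = avoiding {Mu e}" unfolding \<Lambda>(2) paths_def avoiding_def by blast
  then show thesis by (rule that)
qed

text \<open>The forcing step: the class is shrunk so that \<open>c\<close> computes \<open>X\<close> from none of its members.\<close>
lemma avoiding_diagonalize:
  assumes D: "finite D" "avoiding D \<noteq> {}" and X: "\<not> computable X"
  obtains d x where "avoiding (insert d D) \<noteq> {}"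
    "\<And>A. A \<in> avoiding (insert d D) \<Longrightarrow> \<not> computes A c [x] (char_fun X x)"
proof -
  obtain A x where A: "A \<in> avoiding D" "\<not> computes A c [x] (char_fun X x)"
    using computable_if_computed_on_avoiding[OF D] X by blast
  obtain d where d: "\<And>A. (\<exists>z. computes A d [] z) \<longleftrightarrow> computes A c [x] (char_fun X x)"
    using code_halting_iff_output by blast
  have "A \<in> avoiding (insert d D)" using A d unfolding avoiding_def by blast
  then show thesis using d that[of d x] unfolding avoiding_def by blast
qed

instance recf :: countable by countable_datatype

text \<open>The cone avoidance basis theorem of Jockusch and Soare.\<close>
theorem cone_avoidance:
  assumes X: "\<not> computable X" and P: "Pi01_class P" "P \<noteq> {}"
  obtains A where "A \<in> P" "\<not> X \<le>\<^sub>T A"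
proof -
  obtain d0 where d0: "P = avoiding {d0}" using Pi01_class_avoiding[OF P(1)] .
  \<comment> \<open>Step \<open>n\<close> deals with the code number \<open>n\<close>.\<close>
  let ?Q = "\<lambda>n D D'. D \<subseteq> D' \<and>
    (\<exists>x. \<forall>A\<in>avoiding D'. \<not> computes A (from_nat n) [x] (char_fun X x))"
  have "\<exists>D. \<forall>n. (finite (D n) \<and> d0 \<in> D n \<and> avoiding (D n) \<noteq> {}) \<and> ?Q n (D n) (D (Suc n))"
  proof (rule dependent_nat_choice)
    show "\<exists>D. finite D \<and> d0 \<in> D \<and> avoiding D \<noteq> {}"
      using P(2) d0 by (intro exI[of _ "{d0}"]) simp
  next
    fix D and n :: nat assume D: "finite D \<and> d0 \<in> D \<and> avoiding D \<noteq> {}"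
    then obtain d x where "avoiding (insert d D) \<noteq> {}"
      "\<And>A. A \<in> avoiding (insert d D) \<Longrightarrow> \<not> computes A (from_nat n) [x] (char_fun X x)"
      using avoiding_diagonalize[OF _ _ X] by metis
    then show "\<exists>D'. (finite D' \<and> d0 \<in> D' \<and> avoiding D' \<noteq> {}) \<and> ?Q n D D'"
      using D by (intro exI[of _ "insert d D"]) blast
  qed
  then obtain D where *: "\<forall>n. (finite (D n) \<and> d0 \<in> D n \<and> avoiding (D n) \<noteq> {}) \<and>
      ?Q n (D n) (D (Suc n))" by (rule exE)
  have D: "d0 \<in> D n" "avoiding (D n) \<noteq> {}" "D n \<subseteq> D (Suc n)"
    "\<exists>x. \<forall>A\<in>avoiding (D (Suc n)). \<not> computes A (from_nat n) [x] (char_fun X x)" for n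
    using spec[OF *, of n] by simp_all
  obtain A where A: "A \<in> avoiding (\<Union>n. D n)"
    using avoiding_limit[of D] D(2,3) by blast
  have "A \<in> P" using A D(1) unfolding d0 avoiding_def by blast
  moreover have "\<not> X \<le>\<^sub>T A"
  proof
    assume "X \<le>\<^sub>T A"
    then obtain c where "\<And>x. computes A c [x] (char_fun X x)"
      unfolding turing_le_def by blast
    moreover have "A \<in> avoiding (D (Suc (to_nat c)))" using A unfolding avoiding_def by blast
    ultimately show False using D(4)[of "to_nat c"] by fastforce
  qed
  ultimately show thesis by (rule that)
qed

theorem theorem3:
  fixes X :: "nat set" and P :: "nat set set"
  assumes "\<not> computable X"
    and "Pi01_class P"
    and "P \<noteq> {}"
  shows "\<exists>A :: nat \<Rightarrow> nat set. (\<forall>i. A i \<in> P) \<and> \<not> X \<le>\<^sub>T infinite_join A"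
proof -
  obtain A where A: "A \<in> P" "\<not> X \<le>\<^sub>T A"
    using cone_avoidance[OF assms] .
  then have "\<not> X \<le>\<^sub>T infinite_join (\<lambda>_. A)"
    using turing_le_trans infinite_join_constant_turing_le by blast
  then show ?thesis using A(1) by (intro exI[of _ "\<lambda>_. A"]) simp
qed

end
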